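(* Let $\mathbb{F}$ be either $\mathbb{R}$ or $\mathbb{C}$, and let $\mathcal{A}$ be an algebra over $\mathbb{F}$ of $\mathbb{F}$-valued functions defined on a set $\mathbf{T}$, with multiplication $\times$. Then $\mathcal{A}$ is homotonic if and only if the following two conditions hold: (i) $\mathcal{A}$ is closed under forming of absolute values, i.e., $f\in\mathcal{A}$ implies $|f|\in\mathcal{A}$. (ii)$'$ For any four elements $f_1,f_2,g_1,g_2$ in $\mathcal{A}$ such that $|f_1|\le g_1$ and $|f_2|\le g_2$, we have $|f_1\times f_2|\le g_1\times g_2$.
   Context: An algebra $\mathcal{A}$ over $\mathbb{F}$ ($\mathbb{R}$ or $\mathbb{C}$) of $\mathbb{F}$-valued functions on a set $\mathbf{T}$ means a (finite or infinite dimensional) vector space over $\mathbb{F}$ of functions $\mathbf{T}\to\mathbb{F}$, with pointwise addition and scalar multiplication, equipped with an $\mathbb{F}$-bilinear multiplication $\times:\mathcal{A}\times\mathcal{A}\to\mathcal{A}$. The multiplication need not be pointwise, and is not assumed to be associative, commutative or unital. The functions are not assumed to be bounded. For $f\in\mathcal{A}$, $|f|$ is the function defined by $|f|(t)=|f(t)|$ for $t\in\mathbf{T}$. For real valued functions $f,g$ on $\mathbf{T}$, $f\le g$ means $f(t)\le g(t)$ for all $t\in\mathbf{T}$. (When $\mathbb{F}=\mathbb{C}$, writing an inequality between two functions includes the assertion that both functions are real valued.) $\mathcal{A}$ is called homotonic if: (i) $f\in\mathcal{A}$ implies $|f|\in\mathcal{A}$; and (ii) for any two elements $f,g\in\mathcal{A}$,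 $|f\times g|\le |f|\times|g|$. *)

theory Defs
  imports Complex_Main "HOL-Library.FuncSet"
begin

text \<open>
  The scalar type \<open>'f :: real_normed_field\<close> stands for \<open>real\<close> or \<open>complex\<close>.
  A function on \<open>T\<close> is represented by an extensional total function, i.e. one with value
  \<open>undefined\<close> outside \<open>T\<close>, so that \<open>=\<close> is equality of functions on \<open>T\<close>; \<open>T\<close> may be empty.
\<close>

definition fun_zero :: "'t set \<Rightarrow> 't \<Rightarrow> 'f::real_normed_field" where
  "fun_zero T = (\<lambda>t\<in>T. 0)"

definition fun_add :: "'t set \<Rightarrow> ('t \<Rightarrow> 'f::real_normed_field) \<Rightarrow> ('t \<Rightarrow> 'f) \<Rightarrow> 't \<Rightarrow> 'f" where
  "fun_add T f g = (\<lambda>t\<in>T. f t + g t)"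

definition fun_scale :: "'t set \<Rightarrow> 'f::real_normed_field \<Rightarrow> ('t \<Rightarrow> 'f) \<Rightarrow> 't \<Rightarrow> 'f" where
  "fun_scale T c f = (\<lambda>t\<in>T. c * f t)"

definition fun_abs :: "'t set \<Rightarrow> ('t \<Rightarrow> 'f::real_normed_field) \<Rightarrow> 't \<Rightarrow> 'f" where
  "fun_abs T f = (\<lambda>t\<in>T. of_real (norm (f t)))"

text \<open>
  The inequality includes the assertion that both functions are real valued on \<open>T\<close>.
  (The order on \<open>complex\<close> in \<open>HOL-Library.Complex_Order\<close> only asks for equal imaginary parts.)
\<close>

definition fun_le :: "'t set \<Rightarrow> ('t \<Rightarrow> 'f::real_normed_field) \<Rightarrow> ('t \<Rightarrow> 'f) \<Rightarrow> bool" where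
  "fun_le T f g \<longleftrightarrow>
    (\<forall>t\<in>T. \<exists>a b :: real. f t = of_real a \<and> g t = of_real b \<and> a \<le> b)"

text \<open>The values of \<open>mult\<close> outside \<open>A\<close> are irrelevant.\<close>

locale function_algebra =
  fixes T :: "'t set"
    and A :: "('t \<Rightarrow> 'f::real_normed_field) set"
    and mult :: "('t \<Rightarrow> 'f) \<Rightarrow> ('t \<Rightarrow> 'f) \<Rightarrow> 't \<Rightarrow> 'f"
  assumes functions_on: "A \<subseteq> extensional T"
    and zero_closed: "fun_zero T \<in> A"
    and add_closed: "\<lbrakk>f \<in> A; g \<in> A\<rbrakk> \<Longrightarrow> fun_add T f g \<in> A"
    and scale_closed: "f \<in> A \<Longrightarrow> fun_scale T c f \<in> A"
    and mult_closed: "\<lbrakk>f \<in> A; g \<in> A\<rbrakk> \<Longrightarrow> mult f g \<in> A"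
    and mult_add_left:
      "\<lbrakk>f \<in> A; g \<in> A; h \<in> A\<rbrakk> \<Longrightarrow> mult (fun_add T f g) h = fun_add T (mult f h) (mult g h)"
    and mult_add_right:
      "\<lbrakk>f \<in> A; g \<in> A; h \<in> A\<rbrakk> \<Longrightarrow> mult f (fun_add T g h) = fun_add T (mult f g) (mult f h)"
    and mult_scale_left:
      "\<lbrakk>f \<in> A; g \<in> A\<rbrakk> \<Longrightarrow> mult (fun_scale T c f) g = fun_scale T c (mult f g)"
    and mult_scale_right:
      "\<lbrakk>f \<in> A; g \<in> A\<rbrakk> \<Longrightarrow> mult f (fun_scale T c g) = fun_scale T c (mult f g)"

definition homotonic ::
  "'t set \<Rightarrow> ('t \<Rightarrow> 'f::real_normed_field) set \<Rightarrow>
    (('t \<Rightarrow> 'f) \<Rightarrow> ('t \<Rightarrow> 'f) \<Rightarrow> 't \<Rightarrow> 'f) \<Rightarrow> bool" where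
  "homotonic T A mult \<longleftrightarrow>
    (\<forall>f\<in>A. fun_abs T f \<in> A) \<and>
    (\<forall>f\<in>A. \<forall>g\<in>A. fun_le T (fun_abs T (mult f g)) (mult (fun_abs T f) (fun_abs T g)))"

end

theory Submission
  imports Defs
begin

text \<open>
  Write \<open>0 \<le> p\<close> for \<open>fun_le T (fun_zero T) p\<close>. A homotonic algebra has the property that the
  product of two nonnegative elements \<open>p\<close> and \<open>q\<close> is again nonnegative: as \<open>|p| = p\<close> and
  \<open>|q| = q\<close>, homotonicity reads \<open>|p \<times> q| \<le> p \<times> q\<close>, and a function that dominates an absolute
  value is real valued and nonnegative (\<open>homotonic_mult_nonneg\<close>). By bilinearity,
  multiplication is then monotone on nonnegative elements (\<open>homotonic_mult_mono\<close>): if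
  \<open>0 \<le> f\<^sub>1 \<le> g\<^sub>1\<close> and \<open>0 \<le> f\<^sub>2 \<le> g\<^sub>2\<close>, then
  \<open>g\<^sub>1 \<times> g\<^sub>2 - f\<^sub>1 \<times> f\<^sub>2 = f\<^sub>1 \<times> (g\<^sub>2 - f\<^sub>2) + (g\<^sub>1 - f\<^sub>1) \<times> g\<^sub>2\<close>
  is a sum of products of nonnegative elements. Applied to absolute values, this gives
  \<open>|f\<^sub>1 \<times> f\<^sub>2| \<le> |f\<^sub>1| \<times> |f\<^sub>2| \<le> g\<^sub>1 \<times> g\<^sub>2\<close> whenever \<open>|f\<^sub>1| \<le> g\<^sub>1\<close> and \<open>|f\<^sub>2| \<le> g\<^sub>2\<close>.
  Conversely, homotonicity is the special case \<open>g\<^sub>1 = |f\<^sub>1|\<close>, \<open>g\<^sub>2 = |f\<^sub>2|\<close>.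

  The argument works over every real normed field; the real and complex cases are instances.
\<close>

lemma fun_le_trans:
  fixes f g h :: "'t \<Rightarrow> 'f::real_normed_field"
  assumes "fun_le T f g" "fun_le T g h"
  shows "fun_le T f h"
  using assms unfolding fun_le_def by (metis of_real_eq_iff order_trans)

lemma fun_le_fun_abs_refl: "fun_le T (fun_abs T f) (fun_abs T f)"
  by (auto simp: fun_le_def fun_abs_def)

lemma fun_zero_le_iff:
  fixes p :: "'t \<Rightarrow> 'f::real_normed_field"
  shows "fun_le T (fun_zero T) p \<longleftrightarrow> (\<forall>t\<in>T. \<exists>b\<ge>0. p t = of_real b)"
  by (auto simp: fun_le_def fun_zero_def)

lemma fun_zero_le_fun_abs: "fun_le T (fun_zero T) (fun_abs T f)"
  unfolding fun_zero_le_iff fun_abs_def by (metis norm_ge_zero restrict_apply')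

lemma fun_abs_eq_self:
  fixes p :: "'t \<Rightarrow> 'f::real_normed_field"
  assumes "p \<in> extensional T" "fun_le T (fun_zero T) p"
  shows "fun_abs T p = p"
proof (rule extensionalityI[of _ T])
  fix t assume "t \<in> T"
  then obtain b where "b \<ge> 0" "p t = of_real b"
    using assms(2) unfolding fun_zero_le_iff by blast
  then show "fun_abs T p t = p t"
    using \<open>t \<in> T\<close> by (simp add: fun_abs_def)
qed (use assms(1) in \<open>auto simp: fun_abs_def\<close>)

lemma fun_zero_le_fun_add:
  fixes p q :: "'t \<Rightarrow> 'f::real_normed_field"
  assumes "fun_le T (fun_zero T) p" "fun_le T (fun_zero T) q"
  shows "fun_le T (fun_zero T) (fun_add T p q)"
  unfolding fun_zero_le_iff
proof
  fix t assume "t \<in> T"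
  then obtain a b where "a \<ge> 0" "p t = of_real a" "b \<ge> 0" "q t = of_real b"
    using assms unfolding fun_zero_le_iff by blast
  then have "a + b \<ge> 0 \<and> fun_add T p q t = of_real (a + b)"
    using \<open>t \<in> T\<close> by (simp add: fun_add_def)
  then show "\<exists>b\<ge>0. fun_add T p q t = of_real b" by blast
qed

text \<open>
  Nonnegativity of \<open>f\<close> serves to make \<open>f\<close> and \<open>f + d\<close> real valued, which is part of the
  inequality.
\<close>

lemma fun_le_fun_add:
  fixes f d :: "'t \<Rightarrow> 'f::real_normed_field"
  assumes "fun_le T (fun_zero T) f" "fun_le T (fun_zero T) d"
  shows "fun_le T f (fun_add T f d)"
  unfolding fun_le_def
proof
  fix t assume "t \<in> T"
  then obtain a b where "f t = of_real a" "b \<ge> 0" "d t = of_real b"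
    using assms unfolding fun_zero_le_iff by blast
  then have "f t = of_real a \<and> fun_add T f d t = of_real (a + b) \<and> a \<le> a + b"
    using \<open>t \<in> T\<close> by (simp add: fun_add_def)
  then show "\<exists>a b. f t = of_real a \<and> fun_add T f d t = of_real b \<and> a \<le> b" by blast
qed

context function_algebra
begin

text \<open>
  Subtraction enters only here: order statements about elements of \<open>A\<close> become statements
  about adding nonnegative elements of \<open>A\<close>.
\<close>

lemma fun_le_obtain_difference:
  assumes "f \<in> A" "g \<in> A" "fun_le T f g"
  obtains d where "d \<in> A" "fun_le T (fun_zero T) d" "g = fun_add T f d"
proof
  let ?d = "fun_add T g (fun_scale T (- 1) f)"
  show "?d \<in> A"
    using assms by (intro add_closed scale_closed)
  show "fun_le T (fun_zero T) ?d"
    unfolding fun_zero_le_iff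
  proof
    fix t assume "t \<in> T"
    then obtain a b where "f t = of_real a" "g t = of_real b" "a \<le> b"
      using assms(3) unfolding fun_le_def by blast
    then have "b - a \<ge> 0 \<and> ?d t = of_real (b - a)"
      using \<open>t \<in> T\<close> by (simp add: fun_add_def fun_scale_def)
    then show "\<exists>b\<ge>0. ?d t = of_real b" by blast
  qed
  have "g \<in> extensional T"
    using assms(2) functions_on by blast
  then show "g = fun_add T f ?d"
    by (auto simp: fun_add_def fun_scale_def fun_eq_iff extensional_def)
qed

lemma mult_fun_add_fun_add:
  assumes "f1 \<in> A" "d1 \<in> A" "f2 \<in> A" "d2 \<in> A"
  shows "mult (fun_add T f1 d1) (fun_add T f2 d2) =
    fun_add T (mult f1 f2) (fun_add T (mult f1 d2) (mult d1 (fun_add T f2 d2)))"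
  using assms
  by (simp add: mult_add_left mult_add_right add_closed)
    (auto simp: fun_add_def fun_eq_iff restrict_def algebra_simps)

text \<open>
  The right-hand side of \<open>|p \<times> q| \<le> |p| \<times> |q|\<close> is \<open>p \<times> q\<close> itself, which is therefore real valued
  and above an absolute value.
\<close>

lemma homotonic_mult_nonneg:
  assumes "homotonic T A mult" "p \<in> A" "q \<in> A"
    and "fun_le T (fun_zero T) p" "fun_le T (fun_zero T) q"
  shows "fun_le T (fun_zero T) (mult p q)"
proof -
  have "fun_abs T p = p" "fun_abs T q = q"
    using assms functions_on by (auto intro: fun_abs_eq_self)
  moreover have "fun_le T (fun_abs T (mult p q)) (mult (fun_abs T p) (fun_abs T q))"
    using assms(1-3) unfolding homotonic_def by blast
  ultimately have "fun_le T (fun_abs T (mult p q)) (mult p q)"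
    by simp
  then show ?thesis
    using fun_zero_le_fun_abs fun_le_trans by blast
qed

lemma homotonic_mult_mono:
  assumes hom: "homotonic T A mult"
    and A: "f1 \<in> A" "f2 \<in> A" "g1 \<in> A" "g2 \<in> A"
    and f: "fun_le T (fun_zero T) f1" "fun_le T (fun_zero T) f2"
    and le: "fun_le T f1 g1" "fun_le T f2 g2"
  shows "fun_le T (mult f1 f2) (mult g1 g2)"
proof -
  obtain d1 where d1: "d1 \<in> A" "fun_le T (fun_zero T) d1" "g1 = fun_add T f1 d1"
    using fun_le_obtain_difference A le by metis
  obtain d2 where d2: "d2 \<in> A" "fun_le T (fun_zero T) d2" "g2 = fun_add T f2 d2"
    using fun_le_obtain_difference A le by metis
  have "fun_le T (fun_zero T) g2"
    using f(2) le(2) by (rule fun_le_trans)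
  then have "fun_le T (fun_zero T) (fun_add T (mult f1 d2) (mult d1 g2))"
    using hom A f d1 d2 by (intro fun_zero_le_fun_add homotonic_mult_nonneg)
  moreover have "fun_le T (fun_zero T) (mult f1 f2)"
    using hom A f by (intro homotonic_mult_nonneg)
  moreover have "mult g1 g2 = fun_add T (mult f1 f2) (fun_add T (mult f1 d2) (mult d1 g2))"
    using mult_fun_add_fun_add A d1 d2 by simp
  ultimately show ?thesis
    using fun_le_fun_add by metis
qed

lemma homotonic_iff_dominated_mult:
  "homotonic T A mult \<longleftrightarrow>
    (\<forall>f\<in>A. fun_abs T f \<in> A) \<and>
    (\<forall>f1\<in>A. \<forall>f2\<in>A. \<forall>g1\<in>A. \<forall>g2\<in>A.
       fun_le T (fun_abs T f1) g1 \<and> fun_le T (fun_abs T f2) g2 \<longrightarrow>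
       fun_le T (fun_abs T (mult f1 f2)) (mult g1 g2))"
  (is "_ \<longleftrightarrow> ?abs \<and> ?dom")
proof
  assume hom: "homotonic T A mult"
  then have abs: ?abs
    unfolding homotonic_def by blast
  moreover have ?dom
  proof (intro ballI impI, elim conjE)
    fix f1 f2 g1 g2
    assume A: "f1 \<in> A" "f2 \<in> A" "g1 \<in> A" "g2 \<in> A"
      and le: "fun_le T (fun_abs T f1) g1" "fun_le T (fun_abs T f2) g2"
    have "fun_le T (fun_abs T (mult f1 f2)) (mult (fun_abs T f1) (fun_abs T f2))"
      using hom A unfolding homotonic_def by blast
    moreover have "fun_le T (mult (fun_abs T f1) (fun_abs T f2)) (mult g1 g2)"
      using hom A abs le by (intro homotonic_mult_mono fun_zero_le_fun_abs) auto
    ultimately show "fun_le T (fun_abs T (mult f1 f2)) (mult g1 g2)"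
      by (rule fun_le_trans)
  qed
  ultimately show "?abs \<and> ?dom" ..
next
  assume "?abs \<and> ?dom"
  then show "homotonic T A mult"
    unfolding homotonic_def using fun_le_fun_abs_refl by blast
qed

end

theorem theorem2p1:
  fixes T :: "'t set"
    and A :: "('t \<Rightarrow> real) set"
    and mult :: "('t \<Rightarrow> real) \<Rightarrow> ('t \<Rightarrow> real) \<Rightarrow> 't \<Rightarrow> real"
    and A' :: "('t \<Rightarrow> complex) set"
    and mult' :: "('t \<Rightarrow> complex) \<Rightarrow> ('t \<Rightarrow> complex) \<Rightarrow> 't \<Rightarrow> complex"
  shows
    "(function_algebra T A mult \<longrightarrow>
       (homotonic T A mult \<longleftrightarrow>
         (\<forall>f\<in>A. fun_abs T f \<in> A) \<and>
         (\<forall>f1\<in>A. \<forall>f2\<in>A. \<forall>g1\<in>A. \<forall>g2\<in>A.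
            fun_le T (fun_abs T f1) g1 \<and> fun_le T (fun_abs T f2) g2 \<longrightarrow>
            fun_le T (fun_abs T (mult f1 f2)) (mult g1 g2)))) \<and>
     (function_algebra T A' mult' \<longrightarrow>
       (homotonic T A' mult' \<longleftrightarrow>
         (\<forall>f\<in>A'. fun_abs T f \<in> A') \<and>
         (\<forall>f1\<in>A'. \<forall>f2\<in>A'. \<forall>g1\<in>A'. \<forall>g2\<in>A'.
            fun_le T (fun_abs T f1) g1 \<and> fun_le T (fun_abs T f2) g2 \<longrightarrow>
            fun_le T (fun_abs T (mult' f1 f2)) (mult' g1 g2))))"
  using function_algebra.homotonic_iff_dominated_mult[of T A mult]
    function_algebra.homotonic_iff_dominated_mult[of T A' mult']
  by blast

end
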